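(* Let $N\geq 2$, $d\geq 1$ and $i\geq 2$ be integers such that $N=\frac{d(d+i)}{i-1}$, and let $\alpha\in X_{N,d,i}$ be arbitrary. Let $0<A<B<C<D<E<F$ be real numbers and let the planar domain $\Omega_\alpha$ be the polygon bounded by the straight line segments between the vertices (in clockwise order) $(\alpha,A)$, $(T_\alpha^2(\alpha+1),A)$, $(T_\alpha^2(\alpha+1),B)$, $(T_\alpha(\alpha),B)$, $(T_\alpha(\alpha),C)$, $(\alpha+1,C)$, $(\alpha+1,F)$, $(T_\alpha^2(\alpha),F)$, $(T_\alpha^2(\alpha),E)$, $(T_\alpha(\alpha+1),E)$, $(T_\alpha(\alpha+1),D)$, $(\alpha,D)$, and back to $(\alpha,A)$. If the map $\mathcal T_\alpha:\Omega_\alpha\to\Omega_\alpha$ is bijective almost surely with respect to Lebesgue measure, then $$A=E-1=\frac{-(d+i+1)+\sqrt{(d+i+1)^2+4N}}{2},\qquad B=F-1=\frac{-(d+1)+\sqrt{(d-1)^2+4N}}{2},$$ $$C=\frac{N\left(-(d+i-1)+\sqrt{(d+i+1)^2+4N}\right)}{2(d+i+N)},\qquad D=\frac{N\left(-(d+1)+\sqrt{(d-1)^2+4N}\right)}{2(N-d)},$$ and these values indeed satisfy $0<A<B<C<D<E<F$.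
   Context: For an integer $N\ge 2$ and a real $\alpha$ with $0<\alpha\le\sqrt N-1$, put $I_\alpha=[\alpha,\alpha+1]$ and define $T_\alpha:I_\alpha\to[\alpha,\alpha+1)$ by $T_\alpha(x)=\frac Nx-d(x)$, where $d(x)=\lfloor \frac Nx-\alpha\rfloor$ (the dependence on $N$ is suppressed). The values of $d(\cdot)$ are the digits; they form a finite set of consecutive integers $\{d,d+1,\dots,d+i\}$ with smallest digit $d=d(\alpha+1)$ and largest digit $d+i$. The cylinders are $I_k=\{x\in I_\alpha : d(x)=k\}$; the largest digit is always chosen so that every cylinder is an interval (in the exceptional case that $N/\alpha-\alpha$ is an integer, the single point $\alpha$ is given the digit $N/\alpha-\alpha-1$, so that $T_\alpha(\alpha)=\alpha+1$). The interior of $I_k$ is denoted $I_k^{o}$. For positive integers $d,i$, let $\mathcal A_{N,d,i}$ be the set of all $\alpha\in(0,\sqrt N-1]$ for which $T_\alpha$ has digit set $\{d,d+1,\dots,d+i\}$, and let $X_{N,d,i}=\{\alpha\in\mathcal A_{N,d,i} : T_\alpha(\alpha)\in I_d^{o},\ T_\alpha(\alpha+1)\in I_{d+i}^{o}\}$. The two-dimensional map is $\mathcal T_\alpha(x,y)=\left(T_\alpha(x),\frac{N}{d(x)+y}\right)$ for $x\in I_\alpha$. *)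

theory Defs
  imports "HOL-Analysis.Analysis"
begin

(* When N/\<alpha> - \<alpha> is an integer, the floor formula would give the largest digit to the
   single point \<alpha> only; that point is moved to the neighbouring cylinder. *)
definition digit :: "nat \<Rightarrow> real \<Rightarrow> real \<Rightarrow> int" where
  "digit N \<alpha> x =
     (if x = \<alpha> \<and> real N / \<alpha> - \<alpha> \<in> \<int> then \<lfloor>real N / \<alpha> - \<alpha>\<rfloor> - 1
      else \<lfloor>real N / x - \<alpha>\<rfloor>)"

definition Tmap :: "nat \<Rightarrow> real \<Rightarrow> real \<Rightarrow> real" where
  "Tmap N \<alpha> x = real N / x - of_int (digit N \<alpha> x)"

definition cylinder :: "nat \<Rightarrow> real \<Rightarrow> int \<Rightarrow> real set" where
  "cylinder N \<alpha> k = {x \<in> {\<alpha>..\<alpha> + 1}. digit N \<alpha> x = k}"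

definition A_set :: "nat \<Rightarrow> nat \<Rightarrow> nat \<Rightarrow> real set" where
  "A_set N d i =
     {\<alpha>. 0 < \<alpha> \<and> \<alpha> \<le> sqrt (real N) - 1 \<and>
         digit N \<alpha> ` {\<alpha>..\<alpha> + 1} = {int d..int d + int i}}"

definition X_set :: "nat \<Rightarrow> nat \<Rightarrow> nat \<Rightarrow> real set" where
  "X_set N d i =
     {\<alpha> \<in> A_set N d i.
        Tmap N \<alpha> \<alpha> \<in> interior (cylinder N \<alpha> (int d)) \<and>
        Tmap N \<alpha> (\<alpha> + 1) \<in> interior (cylinder N \<alpha> (int d + int i))}"

definition Tmap2 :: "nat \<Rightarrow> real \<Rightarrow> real \<times> real \<Rightarrow> real \<times> real" where
  "Tmap2 N \<alpha> = (\<lambda>(x, y). (Tmap N \<alpha> x, real N / (of_int (digit N \<alpha> x) + y)))"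

definition polygon_boundary :: "(real \<times> real) list \<Rightarrow> (real \<times> real) set" where
  "polygon_boundary vs =
     (\<Union>j<length vs. closed_segment (vs ! j) (vs ! (Suc j mod length vs)))"

definition polygon_region :: "(real \<times> real) list \<Rightarrow> (real \<times> real) set" where
  "polygon_region vs = polygon_boundary vs \<union> inside (polygon_boundary vs)"

definition Omega ::
  "nat \<Rightarrow> real \<Rightarrow> real \<Rightarrow> real \<Rightarrow> real \<Rightarrow> real \<Rightarrow> real \<Rightarrow> real \<Rightarrow> (real \<times> real) set" where
  "Omega N \<alpha> A B C D E F =
     (let T = Tmap N \<alpha> in
      polygon_region
        [(\<alpha>, A), (T (T (\<alpha> + 1)), A), (T (T (\<alpha> + 1)), B), (T \<alpha>, B), (T \<alpha>, C), (\<alpha> + 1, C),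
         (\<alpha> + 1, F), (T (T \<alpha>), F), (T (T \<alpha>), E), (T (\<alpha> + 1), E), (T (\<alpha> + 1), D), (\<alpha>, D)])"

(* Bijectivity almost surely: a null set may be discarded from the domain and another one
   from the codomain. *)
definition bij_betw_ae :: "('a::euclidean_space \<Rightarrow> 'a) \<Rightarrow> 'a set \<Rightarrow> 'a set \<Rightarrow> bool" where
  "bij_betw_ae f S S' \<longleftrightarrow>
     (\<exists>Z \<in> null_sets lebesgue. \<exists>Z' \<in> null_sets lebesgue. bij_betw f (S - Z) (S' - Z'))"

end

theory Submission
  imports Defs
begin

text \<open>
  Write \<open>F\<^sub>k (x, y) = (N/x - k, N/(k + y))\<close> for the branch of the planar map over the cylinder of
  digit \<open>k\<close>, and let the digits be \<open>p = d, \<dots>, q = d + i\<close>.  Over an abscissa \<open>x\<close> the domain has a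
  fibre \<open>[lo x, hi x]\<close>, where \<open>lo\<close> takes the values \<open>A, B, C\<close> and \<open>hi\<close> the values \<open>D, E, F\<close>.  Put
  \<open>u\<^sub>k = N/(k + x)\<close>.  Almost sure bijectivity says that the fibre over \<open>x\<close> is tiled by the images of the
  fibres over the points \<open>u\<^sub>k\<close>, and after the substitution \<open>y \<mapsto> N/y\<close> these images are the intervals
  \<open>[k + lo u\<^sub>k, k + hi u\<^sub>k]\<close>.  Since \<open>lo < hi\<close> everywhere, disjoint intervals of this kind are ordered
  by their digit.  Hence neighbouring tiles must meet, \<open>hi u\<^sub>k = lo u\<^sub>k\<^sub>+\<^sub>1 + 1\<close>
  (\<open>adjacent_fibres_meet\<close>), the tile of the smallest digit reaches the upper edge (\<open>top_fibre\<close>)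
  and that of the largest digit reaches the lower edge (\<open>bottom_fibre\<close>).

  The relation between \<open>N\<close>, \<open>d\<close> and \<open>i\<close> enters through the orbits of the two end points: it is
  equivalent to \<open>N/T\<^sup>2(\<alpha>+1) = N/T\<^sup>2(\<alpha>) + 1\<close> (\<open>matching\<close>).  So the jumps of \<open>lo\<close> at \<open>T\<^sup>2(\<alpha>+1)\<close>
  and of \<open>hi\<close> at \<open>T\<^sup>2(\<alpha>)\<close> lie in neighbouring cylinders and have the same image.  Comparing the
  neighbouring tiles on the two sides of these jumps gives \<open>E = A + 1\<close> and \<open>F = B + 1\<close>.
  Looking at the lowest tile on the two sides of \<open>T(\<alpha>+1)\<close>, and at the highest tile on the two
  sides of \<open>T(\<alpha>)\<close>, gives \<open>A = N/(q+E)\<close>, \<open>B = N/(q+D)\<close>, \<open>F = N/(p+B)\<close> and \<open>E = N/(p+C)\<close>.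
  These six equations have exactly one positive solution, and the relation once more turns it into
  the stated closed form and puts the six heights in increasing order (\<open>heights_increasing\<close>).

  The passage from almost sure to exact statements uses only that a nonempty open set is not null.
  The polygon lies between an open staircase region and its closure, so "the image of almost every
  point of the open region lies in the compact one" improves to every point by continuity, and
  likewise for covering.  For disjointness an overlap of two branch images would be open, and the
  branches, being differentiable, map null sets to null sets.
\<close>

section \<open>Staircase polygons\<close>

text \<open>
  The interval \<open>[a, b]\<close> stands for \<open>I\<^sub>\<alpha>\<close>; the lower edge jumps at \<open>s = T\<^sup>2(\<alpha>+1)\<close> and
  \<open>l = T(\<alpha>)\<close>, the upper edge at \<open>r = T(\<alpha>+1)\<close> and \<open>t = T\<^sup>2(\<alpha>)\<close>.
\<close>

locale staircase =
  fixes a b s l r t A B C D E F :: real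
  assumes bottom_steps: "a < s" "s < l" "l < b"
    and top_steps: "a < r" "r < t" "t < b"
    and heights: "A < B" "B < C" "C < D" "D < E" "E < F"
begin

text \<open>
  At a jump, \<open>lo\<close> takes the larger and \<open>hi\<close> the smaller of the two neighbouring values; this
  convention makes the region between them open.
\<close>

definition lo :: "real \<Rightarrow> real" where
  "lo x = (if x < s then A else if x < l then B else C)"

definition hi :: "real \<Rightarrow> real" where
  "hi x = (if x \<le> r then D else if x \<le> t then E else F)"

definition open_region :: "(real \<times> real) set" where
  "open_region = {(x, y). a < x \<and> x < b \<and> lo x < y \<and> y < hi x}"

definition closed_region :: "(real \<times> real) set" where
  "closed_region = {(x, y). a \<le> x \<and> x \<le> b \<and> A \<le> y \<and> (s < x \<longrightarrow> B \<le> y) \<and> (l < x \<longrightarrow> C \<le> y)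
     \<and> y \<le> F \<and> (x < t \<longrightarrow> y \<le> E) \<and> (x < r \<longrightarrow> y \<le> D)}"

definition vertices :: "(real \<times> real) list" where
  "vertices = [(a, A), (s, A), (s, B), (l, B), (l, C), (b, C),
     (b, F), (t, F), (t, E), (r, E), (r, D), (a, D)]"

lemma in_open_region_iff:
  "(x, y) \<in> open_region \<longleftrightarrow> a < x \<and> x < b \<and> lo x < y \<and> y < hi x"
  by (simp add: open_region_def)

lemma in_closed_region_iff:
  assumes "x \<notin> {s, l, r, t}"
  shows "(x, y) \<in> closed_region \<longleftrightarrow> a \<le> x \<and> x \<le> b \<and> lo x \<le> y \<and> y \<le> hi x"
  using assms bottom_steps top_steps heights
  by (auto simp: closed_region_def lo_def hi_def)

lemma lo_bounds: "A \<le> lo x" "lo x \<le> C"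
  using heights by (auto simp: lo_def)

lemma hi_bounds: "D \<le> hi x" "hi x \<le> F"
  using heights by (auto simp: hi_def)

lemma open_open_region: "open open_region"
proof -
  have "open_region = {p. a < fst p} \<inter> {p. fst p < b} \<inter> {p. A < snd p}
      \<inter> ({p. fst p < s} \<union> {p. B < snd p}) \<inter> ({p. fst p < l} \<union> {p. C < snd p})
      \<inter> {p. snd p < F} \<inter> ({p. t < fst p} \<union> {p. snd p < E}) \<inter> ({p. r < fst p} \<union> {p. snd p < D})"
    using bottom_steps top_steps heights
    by (auto simp: open_region_def lo_def hi_def split: if_splits)
  also have "open \<dots>"
    by (intro open_Int open_Un open_Collect_less continuous_intros)
  finally show ?thesis .
qed

lemma closed_closed_region: "closed closed_region"
proof -
  have "closed_region = {p. a \<le> fst p} \<inter> {p. fst p \<le> b} \<inter> {p. A \<le> snd p}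
      \<inter> ({p. fst p \<le> s} \<union> {p. B \<le> snd p}) \<inter> ({p. fst p \<le> l} \<union> {p. C \<le> snd p})
      \<inter> {p. snd p \<le> F} \<inter> ({p. t \<le> fst p} \<union> {p. snd p \<le> E}) \<inter> ({p. r \<le> fst p} \<union> {p. snd p \<le> D})"
    by (auto simp: closed_region_def not_le not_less)
  also have "closed \<dots>"
    by (intro closed_Int closed_Un closed_Collect_le continuous_intros)
  finally show ?thesis .
qed

lemma closed_region_subset_box: "closed_region \<subseteq> {a..b} \<times> {A..F}"
  by (auto simp: closed_region_def)

lemma compact_closed_region: "compact closed_region"
proof -
  have "bounded closed_region"
    using closed_region_subset_box by (rule bounded_subset[rotated]) (simp add: bounded_Times)
  then show ?thesis
    using closed_closed_region by (simp add: compact_eq_bounded_closed)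
qed

lemma open_region_subset_closed_region: "open_region \<subseteq> closed_region"
  using bottom_steps top_steps heights
  by (auto simp: open_region_def closed_region_def lo_def hi_def split: if_splits)

lemma polygon_boundary_vertices:
  "polygon_boundary vertices =
     {a..s} \<times> {A} \<union> {s} \<times> {A..B} \<union> {s..l} \<times> {B} \<union> {l} \<times> {B..C} \<union> {l..b} \<times> {C} \<union> {b} \<times> {C..F}
     \<union> {t..b} \<times> {F} \<union> {t} \<times> {E..F} \<union> {r..t} \<times> {E} \<union> {r} \<times> {D..E} \<union> {a..r} \<times> {D} \<union> {a} \<times> {A..D}"
proof -
  have "{..<length vertices} = {0, 1, 2, 3, 4, 5, 6, 7, 8, 9, 10, 11}"
    by (auto simp: vertices_def less_Suc_eq)
  then show ?thesis
    using bottom_steps top_steps heights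
    by (simp add: polygon_boundary_def)
       (simp add: vertices_def closed_segment_same_fst closed_segment_same_snd
          closed_segment_eq_real_ivl Un_ac)
qed

lemma polygon_boundary_subset: "polygon_boundary vertices \<subseteq> closed_region"
  using bottom_steps top_steps heights
  by (auto simp: polygon_boundary_vertices closed_region_def)

text \<open>
  The closed region minus the open one is already contained in the boundary polygon, because
  each of its points attains one of the inequalities that define the closed region.
\<close>

lemma frontier_open_region_subset: "frontier open_region \<subseteq> polygon_boundary vertices"
proof -
  have "closure open_region \<subseteq> closed_region"
    by (intro closure_minimal open_region_subset_closed_region closed_closed_region)
  then have "frontier open_region \<subseteq> closed_region - open_region"
    by (auto simp: frontier_def interior_open open_open_region)
  also have "\<dots> \<subseteq> polygon_boundary vertices"
  proof
    fix p assume p: "p \<in> closed_region - open_region"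
    obtain x y where "p = (x, y)" by fastforce
    have cl: "a \<le> x" "x \<le> b" "A \<le> y" "s < x \<Longrightarrow> B \<le> y" "l < x \<Longrightarrow> C \<le> y" "y \<le> F"
      "x < t \<Longrightarrow> y \<le> E" "x < r \<Longrightarrow> y \<le> D"
      using p \<open>p = (x, y)\<close> by (auto simp: closed_region_def)
    have bd: "p \<in> polygon_boundary vertices \<longleftrightarrow> (a \<le> x \<and> x \<le> s \<and> y = A) \<or> (x = s \<and> A \<le> y \<and> y \<le> B)
        \<or> (s \<le> x \<and> x \<le> l \<and> y = B) \<or> (x = l \<and> B \<le> y \<and> y \<le> C) \<or> (l \<le> x \<and> x \<le> b \<and> y = C)
        \<or> (x = b \<and> C \<le> y \<and> y \<le> F) \<or> (t \<le> x \<and> x \<le> b \<and> y = F) \<or> (x = t \<and> E \<le> y \<and> y \<le> F)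
        \<or> (r \<le> x \<and> x \<le> t \<and> y = E) \<or> (x = r \<and> D \<le> y \<and> y \<le> E) \<or> (a \<le> x \<and> x \<le> r \<and> y = D)
        \<or> (x = a \<and> A \<le> y \<and> y \<le> D)"
      by (simp only: \<open>p = (x, y)\<close> polygon_boundary_vertices Un_iff mem_Times_iff fst_conv snd_conv
          atLeastAtMost_iff singleton_iff conj_assoc disj_assoc)
    consider "x = a" | "x = b" | "y \<le> lo x" "x \<noteq> b" | "hi x \<le> y" "x \<noteq> a"
      using p cl \<open>p = (x, y)\<close> by (fastforce simp: open_region_def)
    then show "p \<in> polygon_boundary vertices"
    proof cases
      case 1
      then have "A \<le> y" "y \<le> D" using cl top_steps by auto
      with 1 show ?thesis unfolding bd by simp
    next
      case 2
      then have "C \<le> y" "y \<le> F" using cl bottom_steps by auto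
      with 2 show ?thesis unfolding bd by simp
    next
      case 3
      consider "x < s" | "x = s" | "s < x" "x < l" | "x = l" | "l < x" by linarith
      then show ?thesis
        unfolding bd by cases (use 3 cl bottom_steps in \<open>simp_all add: lo_def\<close>)
    next
      case 4
      consider "x < r" | "x = r" | "r < x" "x < t" | "x = t" | "t < x" by linarith
      then show ?thesis
        unfolding bd by cases (use 4 cl top_steps in \<open>simp_all add: hi_def\<close>)
    qed
  qed
  finally show ?thesis .
qed

text \<open>
  A bounded open set lies inside its own frontier, and enlarging that frontier to the boundary
  polygon removes only points of the polygon, which belong to the region anyway.
\<close>

lemma open_region_subset_polygon: "open_region \<subseteq> polygon_region vertices"
proof -
  have "bounded open_region"
    using compact_closed_region open_region_subset_closed_region
    by (meson bounded_subset compact_imp_bounded)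
  then have "open_region \<subseteq> inside (frontier open_region)"
    using interior_inside_frontier open_open_region by (metis interior_open)
  then show ?thesis
    using inside_mono[OF frontier_open_region_subset] by (auto simp: polygon_region_def)
qed

lemma unbounded_rays:
  fixes x y :: real
  shows "\<not> bounded ({x} \<times> {..y})" "\<not> bounded ({x} \<times> {y..})"
    "\<not> bounded ({..x} \<times> {y})" "\<not> bounded ({x..} \<times> {y})"
proof -
  have *: "\<not> bounded {..z}" "\<not> bounded {z..}" for z :: real
  proof -
    have "min z (m - 1) \<in> {..z}" "\<not> m \<le> min z (m - 1)" "max z (m + 1) \<in> {z..}" "\<not> max z (m + 1) \<le> m" for m
      by auto
    then have "\<not> bdd_below {..z}" "\<not> bdd_above {z..}"
      unfolding bdd_below_def bdd_above_def by metis+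
    then show "\<not> bounded {..z}" and "\<not> bounded {z..}"
      by (auto dest: bounded_imp_bdd_below bounded_imp_bdd_above)
  qed
  show "\<not> bounded ({x} \<times> {..y})" "\<not> bounded ({x} \<times> {y..})"
    using *[of y] bounded_snd[of "{x} \<times> {..y}"] bounded_snd[of "{x} \<times> {y..}"] by auto
  show "\<not> bounded ({..x} \<times> {y})" "\<not> bounded ({x..} \<times> {y})"
    using *[of x] bounded_fst[of "{..x} \<times> {y}"] bounded_fst[of "{x..} \<times> {y}"] by auto
qed

text \<open>
  A point outside the closed region can escape to infinity along a horizontal or vertical ray that
  avoids the boundary: a violated inequality stays violated in one of the four directions.
\<close>

lemma polygon_subset_closed_region: "polygon_region vertices \<subseteq> closed_region"
proof -
  have "p \<in> closed_region" if p: "p \<in> inside (polygon_boundary vertices)" for p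
  proof (rule ccontr)
    assume out: "p \<notin> closed_region"
    obtain x y where xy: "p = (x, y)" by fastforce
    have blocked: False if R: "R \<inter> closed_region = {}" "p \<in> R" "connected R" "\<not> bounded R" for R
    proof -
      have "R \<subseteq> connected_component_set (- polygon_boundary vertices) p"
        using polygon_boundary_subset R by (intro connected_component_maximal) auto
      then show False
        using R p unfolding inside_def mem_Collect_eq using bounded_subset by blast
    qed
    have con: "connected ({x} \<times> {..y})" "connected ({x} \<times> {y..})" "connected ({..x} \<times> {y})" "connected ({x..} \<times> {y})"
      by (intro connected_Times connected_sing connected_Iic connected_Ici)+
    consider "x < a" | "b < x" | "y < A" | "s < x" "y < B" | "l < x" "y < C"
      | "F < y" | "x < t" "E < y" | "x < r" "D < y"
      using out unfolding xy closed_region_def mem_Collect_eq case_prod_conv not_le by linarith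
    then show False
    proof cases
      case 1
      show False
        by (rule blocked[of "{..x} \<times> {y}"]) (use 1 xy con unbounded_rays[of x y] in \<open>auto simp: closed_region_def\<close>)
    next
      case 2
      show False
        by (rule blocked[of "{x..} \<times> {y}"]) (use 2 xy con unbounded_rays[of x y] in \<open>auto simp: closed_region_def\<close>)
    qed (rule blocked[of "{x} \<times> {..y}"] blocked[of "{x} \<times> {y..}"];
         use xy con unbounded_rays[of x y] in \<open>auto simp: closed_region_def\<close>; fail)+
  qed
  then show ?thesis
    using polygon_boundary_subset by (auto simp: polygon_region_def)
qed

end

section \<open>Tilings of the fibres\<close>

definition branch :: "real \<Rightarrow> int \<Rightarrow> real \<times> real \<Rightarrow> real \<times> real" where
  "branch n k = (\<lambda>(x, y). (n / x - of_int k, n / (of_int k + y)))"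

text \<open>
  What remains of almost sure bijectivity once null sets have been eliminated: branches map the
  open region into the closed one, their images of the closed region cover the open one, and
  images of the open region under different branches do not overlap above \<open>(a, a + 1)\<close>.
\<close>

locale branch_tiling = staircase a "a + 1" s l r t A B C D E F
  for a s l r t A B C D E F :: real +
  fixes n :: real and p q :: int
  assumes pos: "0 < a" "0 < n" "1 \<le> p" "p \<le> q" "0 < A"
    and branch_into: "\<And>u y k. \<lbrakk>(u, y) \<in> open_region; k \<in> {p..q}; a < n / u - k; n / u - k < a + 1\<rbrakk>
      \<Longrightarrow> branch n k (u, y) \<in> closed_region"
    and covering: "open_region \<subseteq> (\<Union>k\<in>{p..q}. branch n k ` closed_region)"
    and branches_disjoint: "\<And>P Q j k. \<lbrakk>P \<in> open_region; Q \<in> open_region; j \<in> {p..q}; k \<in> {p..q}; j \<noteq> k;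
      branch n j P = branch n k Q\<rbrakk> \<Longrightarrow> fst (branch n j P) \<notin> {a<..<a + 1}"
begin

abbreviation preimg :: "int \<Rightarrow> real \<Rightarrow> real" where
  "preimg k x \<equiv> n / (of_int k + x)"

lemma digit_pos:
  assumes "k \<in> {p..q}" "0 < x"
  shows "0 < of_int k + x" "0 < real_of_int k" "0 < preimg k x" "n / preimg k x - k = x"
proof -
  show "0 < real_of_int k" using assms pos by auto
  then show "0 < of_int k + x" using assms(2) by linarith
  then show "0 < preimg k x" "n / preimg k x - k = x" using pos by auto
qed

lemma lo_pos: "0 < lo x"
  using lo_bounds(1)[of x] pos by linarith

lemma lo_less_hi: "lo x < hi y"
  using lo_bounds(2)[of x] hi_bounds(1)[of y] heights by linarith

text \<open>
  For a generic abscissa neither the point nor any of its preimages lies at a jump or at an end of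
  the interval, so that the fibres of the open and of the closed region have the same end points.
\<close>

definition generic :: "real \<Rightarrow> bool" where
  "generic x \<longleftrightarrow> x \<notin> {s, l, r, t} \<and> (\<forall>j\<in>{p..q}. preimg j x \<notin> {a, a + 1, s, l, r, t})"

lemma finite_nongeneric: "finite {x. a < x \<and> \<not> generic x}"
proof (rule finite_subset)
  show "finite ({s, l, r, t} \<union> (\<Union>j\<in>{p..q}. (\<lambda>w. n / w - of_int j) ` {a, a + 1, s, l, r, t}))"
    by simp
  have "x \<in> (\<Union>j\<in>{p..q}. (\<lambda>w. n / w - of_int j) ` {a, a + 1, s, l, r, t})"
    if "a < x" "j \<in> {p..q}" "preimg j x \<in> {a, a + 1, s, l, r, t}" for x j
  proof -
    have "x = (\<lambda>w. n / w - of_int j) (preimg j x)"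
      using digit_pos(4)[OF that(2), of x] that pos by simp
    then show ?thesis using that by blast
  qed
  then show "{x. a < x \<and> \<not> generic x} \<subseteq>
      {s, l, r, t} \<union> (\<Union>j\<in>{p..q}. (\<lambda>w. n / w - of_int j) ` {a, a + 1, s, l, r, t})"
    unfolding generic_def by blast
qed

lemma generic_between:
  assumes "a \<le> c" "c < e"
  obtains x where "c < x" "x < e" "generic x"
proof -
  have "infinite {c<..<e}" using assms by simp
  then have "\<not> {c<..<e} \<subseteq> {x. a < x \<and> \<not> generic x}"
    using finite_nongeneric finite_subset by blast
  then show ?thesis using that assms by auto
qed

text \<open>
  The intervals \<open>[j + lo u, j + hi u]\<close> and \<open>[k + lo v, k + hi v]\<close> must not overlap, and the
  alternative order \<open>k + hi v \<le> j + lo u\<close> is excluded by \<open>lo u < hi v\<close>.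
\<close>

lemma digit_order:
  assumes x: "a < x" "x < a + 1" and jk: "j \<in> {p..q}" "k \<in> {p..q}" "j < k"
    and u: "a < preimg j x" "preimg j x < a + 1" and v: "a < preimg k x" "preimg k x < a + 1"
  shows "j + hi (preimg j x) \<le> k + lo (preimg k x)"
proof (rule ccontr)
  let ?u = "preimg j x" and ?v = "preimg k x"
  assume "\<not> ?thesis"
  moreover have "real_of_int j < k" using jk by simp
  \<comment> \<open>A common value \<open>\<tau>\<close> of the two intervals gives two points with the same image \<open>(x, n / \<tau>)\<close>.\<close>
  ultimately have "max (j + lo ?u) (k + lo ?v) < min (j + hi ?u) (k + hi ?v)"
    using lo_less_hi[of ?u ?u] lo_less_hi[of ?u ?v] lo_less_hi[of ?v ?v] by simp
  then obtain \<tau> where \<tau>: "max (j + lo ?u) (k + lo ?v) < \<tau>" "\<tau> < min (j + hi ?u) (k + hi ?v)"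
    using dense by blast
  then have "(?u, \<tau> - j) \<in> open_region" "(?v, \<tau> - k) \<in> open_region"
    using u v by (auto simp: in_open_region_iff)
  moreover have "branch n j (?u, \<tau> - j) = (x, n / \<tau>)" "branch n k (?v, \<tau> - k) = (x, n / \<tau>)"
    using digit_pos(4)[OF jk(1), of x] digit_pos(4)[OF jk(2), of x] x pos by (simp_all add: branch_def)
  ultimately show False
    using branches_disjoint[of "(?u, \<tau> - j)" "(?v, \<tau> - k)" j k] jk x by simp
qed

text \<open>
  The inclusion of branch images holds for the open fibre over the preimage, and passes to its end
  points by density.
\<close>

lemma fibre_image_bounds:
  assumes x: "a < x" "x < a + 1" "generic x" and k: "k \<in> {p..q}"
    and u: "a < preimg k x" "preimg k x < a + 1"
  shows "lo x \<le> n / (k + hi (preimg k x))" "n / (k + lo (preimg k x)) \<le> hi x"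
proof -
  let ?u = "preimg k x"
  have kpos: "0 < real_of_int k" and u_eq: "n / ?u - k = x"
    using digit_pos[OF k, of x] x pos by auto
  have *: "lo x * (k + y) \<le> n \<and> n \<le> hi x * (k + y)" if "lo ?u < y" "y < hi ?u" for y :: real
  proof -
    have "branch n k (?u, y) \<in> closed_region"
      using branch_into[of ?u y k] that u x k u_eq by (simp add: in_open_region_iff)
    then have "(x, n / (k + y)) \<in> closed_region"
      using u_eq by (simp add: branch_def)
    then have "lo x \<le> n / (k + y)" "n / (k + y) \<le> hi x"
      using in_closed_region_iff[of x] x unfolding generic_def by blast+
    moreover have "0 < k + y" using lo_pos[of ?u] that kpos by linarith
    ultimately show ?thesis by (simp add: field_simps)
  qed
  have "hi ?u \<le> n / lo x - k"
  proof (rule dense_le_bounded[OF lo_less_hi[of ?u ?u]])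
    fix y assume "lo ?u < y" "y < hi ?u"
    then show "y \<le> n / lo x - k" using * lo_pos[of x] by (simp add: field_simps)
  qed
  moreover have "0 < k + hi ?u" using kpos lo_pos[of ?u] lo_less_hi[of ?u ?u] by linarith
  ultimately show "lo x \<le> n / (k + hi ?u)" using lo_pos[of x] by (simp add: field_simps)
  have hpos: "0 < hi x" using lo_pos[of x] lo_less_hi[of x x] by linarith
  have "n / hi x - k \<le> lo ?u"
  proof (rule dense_ge_bounded[OF lo_less_hi[of ?u ?u]])
    fix y assume "lo ?u < y" "y < hi ?u"
    then show "n / hi x - k \<le> y" using * hpos by (simp add: field_simps)
  qed
  moreover have "0 < k + lo ?u" using kpos lo_pos[of ?u] by linarith
  ultimately show "n / (k + lo ?u) \<le> hi x" using hpos by (simp add: field_simps)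
qed

lemma fibre_covered:
  assumes x: "a < x" "x < a + 1" "generic x" and y: "lo x < y" "y < hi x"
  obtains j where "j \<in> {p..q}" "a < preimg j x" "preimg j x < a + 1"
    "j + lo (preimg j x) \<le> n / y" "n / y \<le> j + hi (preimg j x)"
proof -
  have "(x, y) \<in> open_region" using x y by (simp add: in_open_region_iff)
  then obtain j w z where j: "j \<in> {p..q}" and wz: "(w, z) \<in> closed_region"
    and eq: "(x, y) = branch n j (w, z)"
    using covering by fastforce
  have xw: "x = n / w - j" and yz: "y = n / (j + z)" using eq by (auto simp: branch_def)
  have w: "w = preimg j x"
    using xw digit_pos(1)[OF j, of x] x pos by (cases "w = 0") (auto simp: field_simps)
  have gen: "w \<notin> {a, a + 1, s, l, r, t}" using x(3) j w by (auto simp: generic_def)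
  have "0 < y" using y(1) lo_pos[of x] by linarith
  then have "n / y = j + z" using yz pos by (cases "j + z = 0") auto
  moreover have "a \<le> w" "w \<le> a + 1" "lo w \<le> z" "z \<le> hi w"
    using wz in_closed_region_iff[of w z] gen by auto
  ultimately show ?thesis using that[OF j] gen w by auto
qed

text \<open>
  By \<open>digit_order\<close> a failure would be a gap between the tiles of \<open>k\<close> and \<open>k + 1\<close>.  A value
  \<open>\<tau>\<close> in the gap has to be covered by a tile of some other digit, but all those lie, again by
  \<open>digit_order\<close>, beyond one of the two tiles that bound the gap.
\<close>

lemma adjacent_fibres_meet:
  assumes x: "a < x" "x < a + 1" "generic x" and k: "k \<in> {p..q}" "k + 1 \<in> {p..q}"
    and u: "a < preimg k x" "preimg k x < a + 1"
    and v: "a < preimg (k + 1) x" "preimg (k + 1) x < a + 1"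
  shows "hi (preimg k x) = lo (preimg (k + 1) x) + 1"
proof (rule ccontr)
  let ?u = "preimg k x" and ?v = "preimg (k + 1) x"
  assume neq: "\<not> ?thesis"
  have "k + hi ?u \<le> k + 1 + lo ?v" using digit_order[OF x(1,2) k _ u v] by simp
  with neq have "k + hi ?u < k + 1 + lo ?v" by linarith
  then obtain \<tau> where \<tau>: "k + hi ?u < \<tau>" "\<tau> < k + 1 + lo ?v" using dense by blast
  have less: "lo ?u < hi ?u" "lo ?v < hi ?v" by (rule lo_less_hi)+
  have kpos: "0 < real_of_int k" using digit_pos(2)[OF k(1) pos(1)] .
  have lopos: "0 < lo ?u" "0 < lo ?v" "0 < lo x" by (rule lo_pos)+
  have \<tau>pos: "0 < \<tau>" using \<tau> kpos less lopos by linarith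
  have "n / (k + 1 + hi ?v) < n / \<tau>"
    using \<tau> \<tau>pos less pos by (intro divide_strict_left_mono) auto
  moreover have "n / \<tau> < n / (k + lo ?u)"
    using \<tau> \<tau>pos less pos lopos kpos by (intro divide_strict_left_mono) auto
  ultimately have "lo x < n / \<tau>" "n / \<tau> < hi x"
    using fibre_image_bounds(1)[OF x k(2) v] fibre_image_bounds(2)[OF x k(1) u] by auto
  moreover have "n / (n / \<tau>) = \<tau>" using pos by simp
  ultimately obtain j where j: "j \<in> {p..q}" "a < preimg j x" "preimg j x < a + 1"
    and cov: "j + lo (preimg j x) \<le> \<tau>" "\<tau> \<le> j + hi (preimg j x)"
    using fibre_covered[OF x, of "n / \<tau>"] by metis
  consider "j < k" | "j = k" | "j = k + 1" | "k + 1 < j" by linarith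
  then show False
  proof cases
    case 1
    then show False
      using digit_order[OF x(1,2) j(1) k(1) 1 j(2,3) u] cov \<tau> less by linarith
  next
    case 4
    then show False
      using digit_order[OF x(1,2) k(2) j(1) 4 v j(2,3)] cov \<tau> less by linarith
  qed (use cov \<tau> in auto)
qed

text \<open>
  Inversion \<open>y \<mapsto> n / y\<close> reverses the order, so the tile of the smallest digit is the highest one
  and nothing else can cover a strip left between it and the upper edge.
\<close>

lemma top_fibre:
  assumes x: "a < x" "x < a + 1" "generic x" and u: "a < preimg p x" "preimg p x < a + 1"
  shows "hi x = n / (p + lo (preimg p x))"
proof (rule ccontr)
  let ?u = "preimg p x"
  have p: "p \<in> {p..q}" using pos by simp
  assume "\<not> ?thesis"
  then have "n / (p + lo ?u) < hi x" using fibre_image_bounds(2)[OF x p u] by linarith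
  then obtain y where y: "n / (p + lo ?u) < y" "y < hi x" using dense by blast
  have ppos: "0 < real_of_int p" using pos by simp
  have less: "0 < lo ?u" "lo ?u < hi ?u" "0 < lo x" using lo_pos lo_less_hi by auto
  have "n / (p + hi ?u) < n / (p + lo ?u)"
    using less ppos pos by (intro divide_strict_left_mono) auto
  then have "lo x < y" using fibre_image_bounds(1)[OF x p u] y by linarith
  then obtain j where j: "j \<in> {p..q}" "a < preimg j x" "preimg j x < a + 1"
    and cov: "j + lo (preimg j x) \<le> n / y"
    using fibre_covered[OF x _ y(2)] by metis
  have "n / y < p + lo ?u"
    using y(1) \<open>lo x < y\<close> less ppos by (simp add: field_simps)
  moreover have "p = j \<or> p < j" using j by auto
  then have "p + lo ?u \<le> j + lo (preimg j x)"
  proof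
    assume "p < j"
    then show ?thesis using digit_order[OF x(1,2) p j(1) _ u j(2,3)] less by linarith
  qed simp
  ultimately show False using cov by linarith
qed

lemma bottom_fibre:
  assumes x: "a < x" "x < a + 1" "generic x" and u: "a < preimg q x" "preimg q x < a + 1"
  shows "lo x = n / (q + hi (preimg q x))"
proof (rule ccontr)
  let ?u = "preimg q x"
  have q: "q \<in> {p..q}" using pos by simp
  assume "\<not> ?thesis"
  then have "lo x < n / (q + hi ?u)" using fibre_image_bounds(1)[OF x q u] by linarith
  then obtain y where y: "lo x < y" "y < n / (q + hi ?u)" using dense by blast
  have qpos: "0 < real_of_int q" using pos by simp
  have less: "0 < lo ?u" "lo ?u < hi ?u" "0 < lo x" using lo_pos lo_less_hi by auto
  have "n / (q + hi ?u) < n / (q + lo ?u)"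
    using less qpos pos by (intro divide_strict_left_mono) auto
  then have "y < hi x" using fibre_image_bounds(2)[OF x q u] y by linarith
  then obtain j where j: "j \<in> {p..q}" "a < preimg j x" "preimg j x < a + 1"
    and cov: "n / y \<le> j + hi (preimg j x)"
    using fibre_covered[OF x y(1)] by metis
  have "q + hi ?u < n / y"
    using y less qpos by (simp add: field_simps)
  moreover have "q = j \<or> j < q" using j by auto
  then have "j + hi (preimg j x) \<le> q + hi ?u"
  proof
    assume "j < q"
    then show ?thesis using digit_order[OF x(1,2) j(1) q _ j(2,3) u] less by linarith
  qed simp
  ultimately show False using cov by linarith
qed

end

section \<open>Equations between the heights\<close>

text \<open>
  The jumps are now the orbit points of \<open>a\<close> and \<open>a + 1\<close>, and \<open>matching\<close> says that the
  preimages of a point under the digits \<open>k\<close> and \<open>k + 1\<close> pass \<open>t\<close> and \<open>s\<close> at the same moment.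
\<close>

locale matched_tiling = branch_tiling +
  assumes r_eq: "r = n / (a + 1) - p" and l_eq: "l = n / a - q"
    and s_eq: "s = n / r - q" and t_eq: "t = n / l - p"
    and matching: "n / s = n / t + 1"
begin

lemma preimg_less_iff:
  assumes "k \<in> {p..q}" "0 < x" "0 < u"
  shows "preimg k x < u \<longleftrightarrow> n / u - k < x" "u < preimg k x \<longleftrightarrow> x < n / u - k"
  using digit_pos(1)[OF assms(1,2)] assms by (simp_all add: field_simps)

text \<open>
  Both closed bounds are needed below, since \<open>n / t - k\<close> may be an end point of \<open>[a, a + 1]\<close>.
\<close>

lemma digit_in_range:
  assumes "a < u" "u < a + 1" "a \<le> n / u - k" "n / u - k \<le> a + 1"
  shows "k \<in> {p..q}"
proof -
  have "n / u < n / a" "n / (a + 1) < n / u"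
    using assms pos by (auto intro!: divide_strict_left_mono)
  then have "real_of_int k < q + 1" "real_of_int p - 1 < k"
    using assms l_eq r_eq bottom_steps top_steps by linarith+
  then show ?thesis by auto
qed

text \<open>
  Let the preimage under the smallest digit lie just to the left, then just to the right of \<open>l\<close>.
  Its image is then just to the right, respectively left, of \<open>t\<close>, since branches reverse the order.
\<close>

lemma top_equations: "F = n / (p + B)" "E = n / (p + C)"
proof -
  have p: "p \<in> {p..q}" using pos by simp
  have "n / l < n / s"
    using bottom_steps pos by (intro divide_strict_left_mono) auto
  then have "t < min (a + 1) (n / s - p)" using t_eq top_steps by auto
  then obtain x where x: "t < x" "x < min (a + 1) (n / s - p)" "generic x"
    using generic_between[of t "min (a + 1) (n / s - p)"] top_steps by auto
  then have "a < x" "0 < x" using top_steps pos by auto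
  then have "preimg p x < l" "s < preimg p x"
    using preimg_less_iff[OF p, of x l] preimg_less_iff[OF p, of x s] x t_eq bottom_steps pos by auto
  then show "F = n / (p + B)"
    using top_fibre[of x] x \<open>a < x\<close> bottom_steps top_steps by (auto simp: lo_def hi_def)
next
  have p: "p \<in> {p..q}" using pos by simp
  obtain x where x: "r < x" "x < t" "generic x"
    using generic_between[of r t] top_steps by auto
  then have "a < x" "0 < x" using top_steps pos by auto
  then have "l < preimg p x" "preimg p x < a + 1"
    using preimg_less_iff[OF p, of x l] preimg_less_iff[OF p, of x "a + 1"] x t_eq r_eq bottom_steps pos
    by auto
  then show "E = n / (p + C)"
    using top_fibre[of x] x \<open>a < x\<close> bottom_steps top_steps by (auto simp: lo_def hi_def)
qed

text \<open>
  The preimage under the largest digit is taken on the two sides of \<open>r\<close>, which is mapped to \<open>s\<close>.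
\<close>

lemma bottom_equations: "A = n / (q + E)" "B = n / (q + D)"
proof -
  have q: "q \<in> {p..q}" using pos by simp
  have "n / t < n / r"
    using top_steps pos by (intro divide_strict_left_mono) auto
  then have "max a (n / t - q) < s" using s_eq bottom_steps by auto
  then obtain x where x: "max a (n / t - q) < x" "x < s" "generic x"
    using generic_between[of "max a (n / t - q)" s] by auto
  then have "a < x" "0 < x" using pos by auto
  then have "preimg q x < t" "r < preimg q x"
    using preimg_less_iff[OF q, of x t] preimg_less_iff[OF q, of x r] x s_eq top_steps pos by auto
  then show "A = n / (q + E)"
    using bottom_fibre[of x] x \<open>a < x\<close> bottom_steps top_steps by (auto simp: lo_def hi_def)
next
  have q: "q \<in> {p..q}" using pos by simp
  obtain x where x: "s < x" "x < l" "generic x"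
    using generic_between[of s l] bottom_steps by auto
  then have "a < x" "0 < x" using bottom_steps pos by auto
  then have "preimg q x < r" "a < preimg q x"
    using preimg_less_iff[OF q, of x r] preimg_less_iff[OF q, of x a] x s_eq l_eq top_steps pos
    by auto
  then show "B = n / (q + D)"
    using bottom_fibre[of x] x \<open>a < x\<close> bottom_steps top_steps by (auto simp: lo_def hi_def)
qed

text \<open>
  The preimages under two neighbouring digits are taken just to the left of \<open>t\<close> and \<open>s\<close> for the
  first equation, just to the right for the second.
\<close>

lemma adjacent_equations: "E = A + 1" "F = B + 1"
proof -
  have order: "n / s < n / a" "n / t < n / r" "n / l < n / s" "n / (a + 1) < n / t"
    using bottom_steps top_steps pos by (auto intro!: divide_strict_left_mono)
  have "s < a + 1" "a < t" using bottom_steps top_steps by auto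
  have posn: "0 < s" "0 < t" "0 < r" "0 < l" "0 < a + 1"
    using bottom_steps top_steps pos by auto
  show "E = A + 1"
  proof -
    \<comment> \<open>If \<open>t\<close> is an end point of a cylinder, its two sides belong to different digits; the floor is
      the digit to the left of \<open>t\<close>, the ceiling below the digit to its right.\<close>
    define k where "k = \<lfloor>n / t - a\<rfloor>"
    have k: "a \<le> n / t - k" "n / t - k < a + 1" unfolding k_def by linarith+
    then have digs: "k \<in> {p..q}" "k + 1 \<in> {p..q}"
      using digit_in_range[of t k] digit_in_range[of s "k + 1"] matching bottom_steps top_steps
      by auto
    define e where "e = Min {a + 1, n / a - (k + 1), n / r - k}"
    have "n / t - k < e" using k order matching by (simp add: e_def)
    then obtain x where x: "n / t - k < x" "x < e" "generic x"
      using generic_between[of "n / t - k" e] k by auto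
    then have "a < x" "0 < x" "x < a + 1" "x < n / a - (k + 1)" "x < n / r - k"
      using k pos by (auto simp: e_def)
    then have "preimg k x < t" "r < preimg k x" "preimg (k + 1) x < s" "a < preimg (k + 1) x"
      using preimg_less_iff[OF digs(1), of x t] preimg_less_iff[OF digs(1), of x r]
        preimg_less_iff[OF digs(2), of x s] preimg_less_iff[OF digs(2), of x a] x matching pos posn
      by auto
    then show ?thesis
      using adjacent_fibres_meet[OF \<open>a < x\<close> \<open>x < a + 1\<close> \<open>generic x\<close> digs] bottom_steps top_steps
      by (auto simp: lo_def hi_def)
  qed
  show "F = B + 1"
  proof -
    define k where "k = \<lceil>n / t - a\<rceil> - 1"
    have k: "a < n / t - k" "n / t - k \<le> a + 1" unfolding k_def by linarith+
    then have digs: "k \<in> {p..q}" "k + 1 \<in> {p..q}"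
      using digit_in_range[of t k] digit_in_range[of s "k + 1"] matching bottom_steps top_steps
      by auto
    define c where "c = Max {a, n / (a + 1) - k, n / l - (k + 1)}"
    have "c < n / t - k" using k order matching by (simp add: c_def)
    then obtain x where x: "c < x" "x < n / t - k" "generic x"
      using generic_between[of c "n / t - k"] by (auto simp: c_def)
    then have "a < x" "0 < x" "x < a + 1" "n / (a + 1) - k < x" "n / l - (k + 1) < x"
      using k pos by (auto simp: c_def)
    then have "t < preimg k x" "preimg k x < a + 1" "s < preimg (k + 1) x" "preimg (k + 1) x < l"
      using preimg_less_iff[OF digs(1), of x t] preimg_less_iff[OF digs(1), of x "a + 1"]
        preimg_less_iff[OF digs(2), of x s] preimg_less_iff[OF digs(2), of x l] x matching pos posn
      by auto
    then show ?thesis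
      using adjacent_fibres_meet[OF \<open>a < x\<close> \<open>x < a + 1\<close> \<open>generic x\<close> digs] bottom_steps top_steps
      by (auto simp: lo_def hi_def)
  qed
qed

end

section \<open>Solving the equations\<close>

lemma smallest_digit_less:
  fixes n p q :: real
  assumes rel: "n * (q - p - 1) = p * q" and pq: "1 \<le> p" "p + 2 \<le> q"
  shows "p < n"
proof -
  have "(n - p) * (q - p - 1) = p * (p + 1)" using rel by (simp add: algebra_simps)
  then have "0 < (n - p) * (q - p - 1)" using pq by simp
  then show ?thesis using pq by (simp add: zero_less_mult_iff)
qed

lemma outer_height_root:
  fixes A q n :: real
  assumes "0 < A" "0 < q" "A * (q + A + 1) = n"
  shows "sqrt ((q + 1)\<^sup>2 + 4 * n) = 2 * A + q + 1"
proof (rule real_sqrt_unique)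
  show "(2 * A + q + 1)\<^sup>2 = (q + 1)\<^sup>2 + 4 * n"
    unfolding assms(3)[symmetric] by (simp add: power2_eq_square algebra_simps)
qed (use assms in simp)

lemma inner_height_root:
  fixes B p n :: real
  assumes "0 < B" "0 < p" "(B + 1) * (p + B) = n"
  shows "sqrt ((p - 1)\<^sup>2 + 4 * n) = 2 * B + p + 1"
proof (rule real_sqrt_unique)
  show "(2 * B + p + 1)\<^sup>2 = (p - 1)\<^sup>2 + 4 * n"
    unfolding assms(3)[symmetric] by (simp add: power2_eq_square algebra_simps)
qed (use assms in simp)

text \<open>
  Rationalising gives \<open>n / (A + 1) = n (A + q) / (q + n)\<close> and \<open>n / B = n (B + p + 1) / (n - p)\<close>.
  The relation between \<open>n\<close>, \<open>p\<close> and \<open>q\<close>, read as \<open>p (q + n) = n (q - 1)\<close> and as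
  \<open>q (n - p) = n (p + 1)\<close>, cancels the additive constants after \<open>p\<close> and \<open>q\<close> have been subtracted.
\<close>

lemma lower_middle_height:
  fixes A C p q n :: real
  assumes rel: "n * (q - p - 1) = p * q" and pos: "0 < A" "0 < p" "0 < q" "0 < n"
    and A: "A * (q + A + 1) = n" and C: "A + 1 = n / (p + C)"
  shows "C = n * (A + 1) / (q + n)"
proof -
  have "p + C \<noteq> 0" using C pos by auto
  then have "(A + 1) * (p + C) = n" using C by (simp add: field_simps)
  then have "(A + 1) * C = n - p * (A + 1)" by (simp add: algebra_simps)
  then have "(A + 1) * (C * (q + n)) = (n - p * (A + 1)) * (q + n)" by (metis mult.assoc)
  also have "\<dots> = n * (n + q - p * (A + 1)) - (p * q) * (A + 1)" by (simp add: algebra_simps)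
  also have "\<dots> = n * (n + 1 - (q - 1) * A)" unfolding rel[symmetric] by (simp add: algebra_simps)
  also have "\<dots> = (A + 1) * (n * (A + 1))" unfolding A[symmetric] by (simp add: algebra_simps)
  finally have "C * (q + n) = n * (A + 1)" using pos by simp
  then show ?thesis using pos by (simp add: field_simps)
qed

lemma upper_middle_height:
  fixes B D p q n :: real
  assumes rel: "n * (q - p - 1) = p * q" and pos: "0 < B" "0 < p" "0 < n" "p < n"
    and B: "(B + 1) * (p + B) = n" and D: "B = n / (q + D)"
  shows "D = n * B / (n - p)"
proof -
  have "q + D \<noteq> 0" using D pos by auto
  then have "B * (q + D) = n" using D by (simp add: field_simps)
  then have "B * D = n - q * B" by (simp add: algebra_simps)
  then have "B * (D * (n - p)) = (n - q * B) * (n - p)" by (metis mult.assoc)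
  also have "\<dots> = n * (n - p) - n * q * B + (p * q) * B" by (simp add: algebra_simps)
  also have "\<dots> = n * (n - p - (p + 1) * B)" unfolding rel[symmetric] by (simp add: algebra_simps)
  also have "\<dots> = B * (n * B)" unfolding B[symmetric] by (simp add: algebra_simps)
  finally have "D * (n - p) = n * B" using pos by simp
  then show ?thesis using pos by (simp add: field_simps)
qed

text \<open>
  The two quadratic polynomials \<open>A (q + A + 1)\<close> and \<open>(A + 1) (p + A)\<close> differ by \<open>p - A (q - p)\<close>, so
  \<open>A < B\<close> amounts to \<open>p < A (q - p)\<close>; this in turn follows by evaluating the first polynomial at
  \<open>p / (q - p)\<close>.  The inequalities \<open>B < C\<close> and \<open>D < E\<close> are \<open>A < B\<close> transported by the decreasing map
  \<open>y \<mapsto> n / y\<close>, and \<open>C < D\<close> uses the closed forms of \<open>C\<close> and \<open>D\<close>.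
\<close>

lemma heights_increasing:
  fixes A B p q n :: real
  assumes rel: "n * (q - p - 1) = p * q" and pq: "1 \<le> p" "p + 2 \<le> q" and pos: "0 < A" "0 < B" "0 < n"
    and A: "A * (q + A + 1) = n" and B: "(B + 1) * (p + B) = n"
  shows "A < B" "B < n / (A + 1) - p" "n / (A + 1) - p < n / B - q" "n / B - q < A + 1"
proof -
  define i where "i = q - p"
  have i: "2 \<le> i" "q = p + i" "n * (i - 1) = p * q" using pq rel by (simp_all add: i_def)
  have np: "(n - p) * (i - 1) = p * (p + 1)" using i(2,3) by (simp add: algebra_simps)
  have pn: "p < n" by (rule smallest_digit_less[OF rel pq])
  have Ai: "p < A * i"
  proof (rule ccontr)
    assume "\<not> p < A * i"
    then have le: "A * i \<le> p" by simp
    have "n * i * i = (A * i) * (q * i + A * i + i)" unfolding A[symmetric] by (simp add: algebra_simps)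
    also have "\<dots> \<le> p * (q * i + p + i)"
      using le pos pq i by (intro mult_mono add_mono) auto
    also have "\<dots> = p * q * (i + 1)" using i(2) by (simp add: algebra_simps)
    finally have "n * i * i * (i - 1) \<le> p * q * (i + 1) * (i - 1)"
      using i by (intro mult_right_mono) auto
    moreover have "n * i * i * (i - 1) = p * q * i * i"
      using i(3) by (metis mult.assoc mult.commute)
    ultimately have "p * q \<le> 0" by (simp add: algebra_simps)
    moreover have "0 < p * q" using pq by (intro mult_pos_pos) linarith+
    ultimately show False by simp
  qed
  show AB: "A < B"
  proof (rule ccontr)
    assume "\<not> A < B"
    then have "n \<le> (A + 1) * (p + A)"
      unfolding B[symmetric] using pos pq by (intro mult_mono) auto
    also have "\<dots> = A * (q + A + 1) + (p - A * i)" using i(2) by (simp add: algebra_simps)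
    also have "\<dots> < n" using A Ai by simp
    finally show False by simp
  qed
  have Bp: "n / (B + 1) = p + B" using B pos by (simp add: field_simps)
  have "n / (B + 1) < n / (A + 1)" using AB pos by (intro divide_strict_left_mono) auto
  then show "B < n / (A + 1) - p" using Bp by simp
  have Aq: "n / A = q + A + 1" using A pos by (simp add: field_simps)
  have "n / B < n / A" using AB pos by (intro divide_strict_left_mono) auto
  then show "n / B - q < A + 1" using Aq by simp
  have "n / (A + 1) - p = n * (A + 1) / (q + n)"
  proof (rule lower_middle_height[OF rel pos(1) _ _ pos(3) A])
    show "A + 1 = n / (p + (n / (A + 1) - p))" using pos by simp
  qed (use pq in simp_all)
  moreover have "n / B - q = n * B / (n - p)"
  proof (rule upper_middle_height[OF rel pos(2) _ pos(3) pn B])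
    show "B = n / (q + (n / B - q))" using pos by simp
  qed (use pq in simp)
  moreover have "n * (A + 1) / (q + n) < n * B / (n - p)"
  proof -
    have "(p + 1) * i \<le> (2 * p + i) * (i - 1)"
    proof -
      have "0 \<le> (p + i) * (i - 2)" using pq i by (intro mult_nonneg_nonneg) auto
      then show ?thesis by (simp add: algebra_simps)
    qed
    then have "p * ((p + 1) * i) \<le> p * ((2 * p + i) * (i - 1))" using pq by simp
    then have "((n - p) * i) * (i - 1) \<le> (p * (p + q)) * (i - 1)"
      using np i(2) by (simp add: algebra_simps)
    then have "(n - p) * i \<le> p * (p + q)" using i(1) by (simp add: mult_le_cancel_right)
    also have "\<dots> < (A * i) * (p + q)" using Ai pq by (intro mult_strict_right_mono) auto
    finally have "(n - p) < A * (p + q)" using i(1) by (simp add: mult.commute mult.left_commute)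
    then have "(A + 1) * (n - p) < A * (q + n)" by (simp add: algebra_simps)
    also have "\<dots> < B * (q + n)" using AB pq pos by (intro mult_strict_right_mono) auto
    finally have "n * ((A + 1) * (n - p)) < n * (B * (q + n))" using pos by simp
    then show ?thesis using pos pq pn by (simp add: divide_simps mult_ac)
  qed
  ultimately show "n / (A + 1) - p < n / B - q" by simp
qed

section \<open>The orbits of the end points\<close>

lemma digit_eq_floor: "x \<noteq> a \<Longrightarrow> digit N a x = \<lfloor>real N / x - a\<rfloor>"
  by (simp add: digit_def)

lemma Tmap2_eq_branch: "digit N a x = k \<Longrightarrow> Tmap2 N a (x, y) = branch (real N) k (x, y)"
  by (simp add: Tmap2_def Tmap_def branch_def)

text \<open>
  The exceptional digit at \<open>a\<close> does not break monotonicity: when \<open>N / a - a\<close> is an integer, every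
  point to the right of \<open>a\<close> has a floor that is smaller by at least one.
\<close>

lemma digit_antimono:
  assumes "0 < N" "0 < a" "a \<le> x" "x \<le> y"
  shows "digit N a y \<le> digit N a x"
proof -
  have le: "real N / y - a \<le> real N / x - a"
    using assms by (simp add: divide_left_mono)
  show ?thesis
  proof (cases "x = a \<and> y \<noteq> a \<and> real N / a - a \<in> \<int>")
    case True
    then have "real N / y - a < real N / a - a"
      using assms by (intro diff_strict_right_mono divide_strict_left_mono) auto
    moreover have "real_of_int \<lfloor>real N / a - a\<rfloor> = real N / a - a"
      using True by simp
    ultimately have "\<lfloor>real N / y - a\<rfloor> < \<lfloor>real N / a - a\<rfloor>" by linarith
    then show ?thesis using True by (simp add: digit_def)
  next
    case False
    then show ?thesis using le assms by (auto simp: digit_def floor_mono)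
  qed
qed

text \<open>
  At an interior point of a cylinder the bounds for the image are strict, because they also hold at
  nearby points on either side.  This is what keeps the orbit points away from the ends of \<open>I\<^sub>\<alpha>\<close>.
\<close>

lemma interior_cylinder_digit:
  assumes "0 < N" "0 < a" "x \<in> interior (cylinder N a k)"
  shows "a < x" "x < a + 1" "digit N a x = k" "a < real N / x - k" "real N / x - k < a + 1"
proof -
  obtain e where e: "0 < e" "ball x e \<subseteq> cylinder N a k"
    using assms(3) by (meson mem_interior)
  have "x - e / 2 \<in> ball x e" "x + e / 2 \<in> ball x e" "x - e / 4 \<in> ball x e" "x \<in> ball x e"
    using e by (auto simp: dist_real_def)
  then have c: "x - e / 2 \<in> cylinder N a k" "x + e / 2 \<in> cylinder N a k" "x - e / 4 \<in> cylinder N a k"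
    "x \<in> cylinder N a k"
    using e by blast+
  then show x: "a < x" "x < a + 1" "digit N a x = k" using e by (auto simp: cylinder_def)
  have "a < x - e / 4" "a < x + e / 2" using c e by (auto simp: cylinder_def)
  then have "\<lfloor>real N / (x - e / 4) - a\<rfloor> = k" "\<lfloor>real N / (x + e / 2) - a\<rfloor> = k"
    using c by (auto simp: cylinder_def digit_eq_floor)
  moreover have "real N / x < real N / (x - e / 4)" "real N / (x + e / 2) < real N / x"
    using \<open>a < x - e / 4\<close> \<open>a < x\<close> e assms by (auto intro!: divide_strict_left_mono)
  ultimately show "a < real N / x - k" "real N / x - k < a + 1" by linarith+
qed

locale matched_parameters =
  fixes N d i :: nat and a :: real
  assumes N: "N \<ge> 2" and d: "d \<ge> 1" and i: "i \<ge> 2"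
    and N_eq: "real N = real d * (real d + real i) / (real i - 1)"
    and a_in: "a \<in> X_set N d i"
begin

definition l where "l = Tmap N a a"
definition r where "r = Tmap N a (a + 1)"
definition t where "t = Tmap N a l"
definition s where "s = Tmap N a r"

lemma a_pos: "0 < a" and digit_image: "digit N a ` {a..a + 1} = {int d..int d + int i}"
  using a_in by (auto simp: X_set_def A_set_def)

lemma digit_range: "a \<le> x \<Longrightarrow> x \<le> a + 1 \<Longrightarrow> digit N a x \<in> {int d..int d + int i}"
  using digit_image by (metis atLeastAtMost_iff imageI)

lemma digit_right_end: "digit N a (a + 1) = int d"
proof -
  have "int d \<in> digit N a ` {a..a + 1}" using digit_image by simp
  then obtain x where "x \<in> {a..a + 1}" "digit N a x = int d" by auto
  then have "digit N a (a + 1) \<le> int d" using digit_antimono[of N a x "a + 1"] a_pos N by auto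
  then show ?thesis using digit_range[of "a + 1"] by auto
qed

lemma digit_left_end: "digit N a a = int d + int i"
proof -
  have "int d + int i \<in> digit N a ` {a..a + 1}" using digit_image by simp
  then obtain x where "x \<in> {a..a + 1}" "digit N a x = int d + int i" by auto
  then have "int d + int i \<le> digit N a a" using digit_antimono[of N a a x] a_pos N by auto
  then show ?thesis using digit_range[of a] by auto
qed

lemma l_interior: "l \<in> interior (cylinder N a (int d))"
  and r_interior: "r \<in> interior (cylinder N a (int d + int i))"
  using a_in by (auto simp: X_set_def l_def r_def)

lemmas l_facts = interior_cylinder_digit[OF _ a_pos l_interior]
lemmas r_facts = interior_cylinder_digit[OF _ a_pos r_interior]

lemma orbit_equations:
  "r = N / (a + 1) - d" "l = N / a - (d + i)" "s = N / r - (d + i)" "t = N / l - d"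
  using N digit_left_end digit_right_end l_facts(3) r_facts(3)
  by (auto simp: l_def r_def s_def t_def Tmap_def)

lemma relation: "real N * (real i - 1) = real d * (real d + real i)"
  using N_eq i by (simp add: field_simps)

lemma s_t_bounds: "a < s" "s < a + 1" "a < t" "t < a + 1"
  using l_facts(4,5) r_facts(4,5) N orbit_equations by auto

text \<open>
  Both \<open>s\<close> and \<open>t\<close> are fractional linear in \<open>a\<close>, and the relation between \<open>N\<close>, \<open>d\<close> and \<open>i\<close> makes
  their numerators equal to the same multiple \<open>N m\<close> of \<open>m = i a - d\<close>, which is also the difference of
  their denominators.
\<close>

lemma matching: "N / s = N / t + 1"
proof -
  define u where "u = N - d * (a + 1)"
  define w where "w = N - (d + i) * a"
  define m where "m = i * a - d"
  have rl: "r = u / (a + 1)" "l = w / a"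
    using orbit_equations(1,2) a_pos by (simp_all add: u_def w_def field_simps)
  then have uw: "0 < u" "0 < w"
    using l_facts(1) r_facts(1) N a_pos by (auto simp: zero_less_divide_iff dest: order.strict_trans[OF a_pos])
  have "s * u = N * (a + 1) - (d + i) * u"
    using orbit_equations(3) rl(1) uw a_pos by (simp add: field_simps)
  also have "\<dots> = N * (a + 1) - (d + i) * N + (real d * (real d + real i)) * (a + 1)"
    by (simp add: u_def algebra_simps)
  also have "\<dots> = N * m" unfolding relation[symmetric] by (simp add: m_def algebra_simps)
  finally have su: "s * u = N * m" .
  have "t * w = N * a - d * w"
    using orbit_equations(4) rl(2) uw a_pos by (simp add: field_simps)
  also have "\<dots> = N * a - d * N + (real d * (real d + real i)) * a"
    by (simp add: w_def algebra_simps)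
  also have "\<dots> = N * m" unfolding relation[symmetric] by (simp add: m_def algebra_simps)
  finally have tw: "t * w = N * m" .
  have st: "0 < s" "0 < t" using s_t_bounds a_pos by linarith+
  have "0 < N * m" using su st uw by (metis mult_pos_pos)
  then have "m \<noteq> 0" by auto
  then have "N / s = u / m" "N / t = w / m"
    using su tw st by (simp_all add: field_simps)
  moreover have "u = w + m" by (simp add: u_def w_def m_def algebra_simps)
  ultimately show ?thesis using \<open>m \<noteq> 0\<close> by (simp add: add_divide_distrib)
qed

text \<open>
  By \<open>matching\<close> the digit of \<open>s\<close> exceeds the digit of \<open>t\<close> by one.  So the former is not the smallest
  digit, whereas \<open>l\<close> has the smallest one, and the latter is not the largest digit, which is that of
  \<open>r\<close>.
\<close>

lemma orbit_order: "s < l" "r < t"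
proof -
  have st: "0 < s" "0 < t" "0 < l" "0 < r" using s_t_bounds a_pos l_facts(1) r_facts(1) N by auto
  define k where "k = digit N a t"
  have k: "k = \<lfloor>N / t - a\<rfloor>" "k + 1 = \<lfloor>N / s - a\<rfloor>"
    using s_t_bounds matching by (auto simp: k_def digit_eq_floor) linarith+
  have "k \<in> {int d..int d + int i}" "k + 1 \<in> {int d..int d + int i}"
    using digit_range[of t] digit_range[of s] s_t_bounds k by (auto simp: k_def digit_eq_floor)
  then have "int d + 1 \<le> \<lfloor>N / s - a\<rfloor>" "\<lfloor>N / t - a\<rfloor> < int d + int i"
    using k by auto
  then have "real d + 1 \<le> N / s - a" "N / t - a < real d + real i"
    by (simp_all add: le_floor_iff floor_less_iff)
  moreover have "N / l - d < a + 1" "a < N / r - (d + i)"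
    using l_facts(5) r_facts(4) N by simp_all
  ultimately have "N / l < N / s" "N / t < N / r" by linarith+
  then show "s < l" "r < t" using st N by (simp_all add: field_simps)
qed

end

section \<open>From almost sure bijectivity to the tiling\<close>

definition inverse_branch :: "real \<Rightarrow> int \<Rightarrow> real \<times> real \<Rightarrow> real \<times> real" where
  "inverse_branch n k = (\<lambda>(x, y). (n / (of_int k + x), n / y - of_int k))"

lemma branch_inverse_branch:
  assumes "0 < n" "0 < of_int k + x" "0 < y"
  shows "branch n k (inverse_branch n k (x, y)) = (x, y)"
  using assms by (simp add: branch_def inverse_branch_def)

lemma inverse_branch_branch:
  assumes "0 < n" "0 < x" "0 < of_int k + y"
  shows "inverse_branch n k (branch n k (x, y)) = (x, y)"
  using assms by (simp add: branch_def inverse_branch_def)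

lemma continuous_on_branch:
  assumes "\<And>x y. (x, y) \<in> S \<Longrightarrow> 0 < x \<and> 0 < of_int k + y"
  shows "continuous_on S (branch n k)"
  unfolding branch_def case_prod_beta
  by (intro continuous_intros) (use assms in fastforce)+

lemma continuous_on_inverse_branch:
  assumes "\<And>x y. (x, y) \<in> S \<Longrightarrow> 0 < of_int k + x \<and> 0 < y"
  shows "continuous_on S (inverse_branch n k)"
  unfolding inverse_branch_def case_prod_beta
  by (intro continuous_intros) (use assms in fastforce)+

lemma differentiable_on_branch:
  assumes "\<And>x y. (x, y) \<in> S \<Longrightarrow> 0 < x \<and> 0 < of_int k + y"
  shows "branch n k differentiable_on S"
proof (rule differentiable_at_imp_differentiable_on)
  fix P assume "P \<in> S"
  then have "fst P \<noteq> 0" "of_int k + snd P \<noteq> 0" using assms[of "fst P" "snd P"] by auto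
  then have "((\<lambda>P. (n / fst P - of_int k, n / (of_int k + snd P))) has_derivative
      (\<lambda>h. (- (n * fst h / (fst P)\<^sup>2), - (n * snd h / (of_int k + snd P)\<^sup>2)))) (at P)"
    by (auto intro!: derivative_eq_intros simp: power2_eq_square field_simps)
  then show "branch n k differentiable at P"
    unfolding branch_def case_prod_beta differentiable_def by blast
qed

lemma open_minus_null:
  fixes V :: "'a::euclidean_space set"
  assumes "open V" "P \<in> V" "negligible Z"
  obtains Q where "Q \<in> V - Z"
  using assms open_not_negligible[of V] negligible_subset[of Z V] by blast

context matched_parameters
begin

text \<open>
  The three properties of \<open>branch_tiling\<close> are derived by contradiction.  Each time a counterexample
  persists on a nonempty open set, which contains a point outside the exceptional null sets.
\<close>

lemma boundary_heights:
  fixes A B C D E F :: real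
  assumes level_order: "0 < A" "A < B" "B < C" "C < D" "D < E" "E < F"
    and bij: "bij_betw_ae (Tmap2 N a) (Omega N a A B C D E F) (Omega N a A B C D E F)"
  shows "A = N / (d + i + E)" "B = N / (d + i + D)" "F = N / (d + B)" "E = N / (d + C)"
    "E = A + 1" "F = B + 1"
proof -
  let ?S = "Omega N a A B C D E F" and ?f = "Tmap2 N a" and ?n = "real N"
  let ?p = "int d" and ?q = "int d + int i"
  interpret staircase a "a + 1" s l r t A B C D E F
    using s_t_bounds orbit_order l_facts r_facts N level_order by unfold_locales auto
  have Omega: "?S = polygon_region vertices"
    unfolding Omega_def Let_def vertices_def by (simp only: s_def t_def l_def r_def)
  have US: "open_region \<subseteq> ?S" and SK: "?S \<subseteq> closed_region"
    using open_region_subset_polygon polygon_subset_closed_region Omega by auto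
  obtain Z Z' where Z: "negligible Z" "negligible Z'" and bijf: "bij_betw ?f (?S - Z) (?S - Z')"
    using bij unfolding bij_betw_ae_def negligible_iff_null_sets by blast
  have n: "0 < ?n" using N by simp
  have K_pos: "0 < x \<and> 0 < y" if "(x, y) \<in> closed_region" for x y
    using closed_region_subset_box that a_pos level_order(1) by fastforce
  have U_bounds: "a < x \<and> x < a + 1 \<and> 0 < y" if "(x, y) \<in> open_region" for x y
    using that K_pos[OF subsetD[OF open_region_subset_closed_region that]]
    by (simp add: in_open_region_iff)
  have k_pos: "0 < real_of_int k" if "k \<in> {?p..?q}" for k using that d by auto
  have denominators_pos: "0 < x \<and> 0 < of_int k + y"
    if "(x, y) \<in> closed_region" "k \<in> {?p..?q}" for x y k
    using K_pos[OF that(1)] k_pos[OF that(2)] by linarith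
  note denominators_pos_open = denominators_pos[OF subsetD[OF open_region_subset_closed_region]]
  have f_branch: "?f (x, y) = branch ?n k (x, y)"
    if "a < x" "a < ?n / x - k" "?n / x - k < a + 1" for x y k
  proof -
    have "\<lfloor>?n / x - a\<rfloor> = k" using that by linarith
    then show ?thesis using that Tmap2_eq_branch[of N a x k] by (simp add: digit_eq_floor)
  qed

  have into: "branch ?n k (u, y) \<in> closed_region"
    if uy: "(u, y) \<in> open_region" and k: "k \<in> {?p..?q}" and u: "a < ?n / u - k" "?n / u - k < a + 1" for u y k
  proof (rule ccontr)
    assume out: "branch ?n k (u, y) \<notin> closed_region"
    \<comment> \<open>The strip \<open>(a, a + 1)\<close> ensures that \<open>k\<close> is the actual digit throughout \<open>?V\<close>.\<close>
    let ?V = "open_region \<inter> branch ?n k -` ({a<..<a + 1} \<times> UNIV - closed_region)"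
    have "continuous_on open_region (branch ?n k)"
      using denominators_pos_open[OF _ k] by (rule continuous_on_branch)
    then have "open ?V"
      by (intro continuous_open_preimage open_open_region open_Diff open_Times closed_closed_region) auto
    moreover have "(u, y) \<in> ?V" using uy u out by (simp add: branch_def)
    ultimately obtain P where P: "P \<in> ?V - Z" using Z(1) by (rule open_minus_null)
    obtain x z where xz: "P = (x, z)" by fastforce
    have "fst (branch ?n k P) \<in> {a<..<a + 1}" using P by (simp add: mem_Times_iff)
    then have "a < ?n / x - k" "?n / x - k < a + 1" by (simp_all add: branch_def xz)
    moreover have "a < x" using P U_bounds[of x z] by (simp add: xz)
    ultimately have "?f P = branch ?n k P" unfolding xz by (intro f_branch)
    moreover have "P \<in> ?S - Z" using P US by auto
    then have "?f P \<in> ?S" using bij_betwE[OF bijf] by blast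
    then have "?f P \<in> closed_region" using SK by blast
    ultimately show False using P by simp
  qed

  have cover: "open_region \<subseteq> (\<Union>k\<in>{?p..?q}. branch ?n k ` closed_region)" (is "_ \<subseteq> ?R")
  proof (rule ccontr)
    assume "\<not> open_region \<subseteq> ?R"
    then obtain P where "P \<in> open_region - ?R" by blast
    moreover have "compact (branch ?n k ` closed_region)" if "k \<in> {?p..?q}" for k
      using denominators_pos[OF _ that]
      by (intro compact_continuous_image continuous_on_branch compact_closed_region)
    then have "open (open_region - ?R)"
      by (intro open_Diff open_open_region compact_imp_closed compact_UN) auto
    ultimately obtain Q where Q: "Q \<in> open_region - ?R - Z'"
      using open_minus_null Z by blast
    then have "Q \<in> ?f ` (?S - Z)" using US bijf by (auto simp: bij_betw_def)
    then obtain x y where xy: "(x, y) \<in> ?S" "Q = ?f (x, y)" by fastforce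
    then have K: "(x, y) \<in> closed_region" using SK by blast
    then have "digit N a x \<in> {?p..?q}"
      using digit_range closed_region_subset_box by auto
    then have "Q \<in> ?R" using Tmap2_eq_branch[of N a x] xy(2) K by blast
    then show False using Q by blast
  qed

  have disjoint: "fst (branch ?n j P) \<notin> {a<..<a + 1}"
    if P: "P \<in> open_region" and Q: "Q \<in> open_region" and jk: "j \<in> {?p..?q}" "k \<in> {?p..?q}" "j \<noteq> k"
      and eq: "branch ?n j P = branch ?n k Q" for P Q j k
  proof
    assume strip: "fst (branch ?n j P) \<in> {a<..<a + 1}"
    let ?W = "{a<..<a + 1} \<times> {0<..} :: (real \<times> real) set"
    let ?V = "?W \<inter> inverse_branch ?n j -` open_region \<inter> (?W \<inter> inverse_branch ?n k -` open_region)"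
    have W: "0 < x \<and> 0 < of_int m + x \<and> 0 < y" if "(x, y) \<in> ?W" "m \<in> {?p..?q}" for x y m
      using that k_pos[OF that(2)] a_pos by auto
    have "open (?W \<inter> inverse_branch ?n m -` open_region)" if "m \<in> {?p..?q}" for m
      using W[OF _ that] open_open_region
      by (intro continuous_open_preimage continuous_on_inverse_branch open_Times) auto
    from open_Int[OF this[OF jk(1)] this[OF jk(2)]] have openV: "open ?V" .
    have inv: "inverse_branch ?n m (branch ?n m X) = X \<and> 0 < snd (branch ?n m X)"
      if "X \<in> open_region" "m \<in> {?p..?q}" for X m
    proof -
      obtain x y where "X = (x, y)" by fastforce
      then show ?thesis
        using denominators_pos_open[of x y m] that n inverse_branch_branch[of ?n x m y]
        by (simp add: branch_def)
    qed
    have inV: "branch ?n j P \<in> ?V"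
      using inv[OF P jk(1)] inv[OF Q jk(2)] strip P Q eq by (auto simp: mem_Times_iff)
    \<comment> \<open>Only points whose two preimages avoid \<open>Z\<close> contradict injectivity; the others form a null set.\<close>
    have "negligible (branch ?n m ` (Z \<inter> open_region))" if "m \<in> {?p..?q}" for m
      using denominators_pos_open[OF _ that] Z(1)
      by (intro negligible_differentiable_image_negligible differentiable_on_branch negligible_Int) auto
    then have "negligible (branch ?n j ` (Z \<inter> open_region) \<union> branch ?n k ` (Z \<inter> open_region))"
      using jk by simp
    with openV inV obtain X
      where "X \<in> ?V - (branch ?n j ` (Z \<inter> open_region) \<union> branch ?n k ` (Z \<inter> open_region))"
      by (rule open_minus_null)
    then have X: "X \<in> ?V"
      and notin: "X \<notin> branch ?n j ` (Z \<inter> open_region)" "X \<notin> branch ?n k ` (Z \<inter> open_region)"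
      by simp_all
    obtain x y where xy: "X = (x, y)" by fastforce
    have lift: "inverse_branch ?n m X \<in> ?S - Z \<and> ?f (inverse_branch ?n m X) = X"
      if m: "m \<in> {?p..?q}" and U: "inverse_branch ?n m X \<in> open_region"
        and out: "X \<notin> branch ?n m ` (Z \<inter> open_region)" for m
    proof -
      have pos: "a < x" "x < a + 1" "0 < of_int m + x" "0 < y" using X W[of x y m] m xy by auto
      have X_eq: "branch ?n m (inverse_branch ?n m X) = X"
        unfolding xy using pos n by (intro branch_inverse_branch)
      have "?f (inverse_branch ?n m X) = branch ?n m (inverse_branch ?n m X)"
        using U U_bounds pos n unfolding xy inverse_branch_def case_prod_conv
        by (intro f_branch) auto
      then show ?thesis using X_eq U US out by force
    qed
    have "inverse_branch ?n j X = inverse_branch ?n k X"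
      using lift[OF jk(1)] lift[OF jk(2)] X notin bijf unfolding bij_betw_def inj_on_def
      by (metis IntD1 IntD2 vimageE)
    then have "?n / (of_int j + x) = ?n / (of_int k + x)" by (simp add: inverse_branch_def xy)
    then show False
      using W[of x y j] W[of x y k] X xy jk n by (auto simp: field_simps)
  qed

  interpret matched_tiling a s l r t A B C D E F ?n ?p ?q
  proof unfold_locales
    show "0 < a" "0 < ?n" "1 \<le> ?p" "?p \<le> ?q" "0 < A" using a_pos n d level_order by auto
    show "r = ?n / (a + 1) - of_int ?p" "l = ?n / a - of_int ?q"
      "s = ?n / r - of_int ?q" "t = ?n / l - of_int ?p"
      unfolding of_nat_add[symmetric] of_int_of_nat_eq by (fact orbit_equations)+
  qed (fact into cover disjoint matching)+
  show "A = N / (d + i + E)" "B = N / (d + i + D)" "F = N / (d + B)" "E = N / (d + C)"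
    "E = A + 1" "F = B + 1"
    using top_equations bottom_equations adjacent_equations
    unfolding of_int_add of_int_of_nat_eq of_nat_add by blast+
qed

end

section \<open>The heights of the domain\<close>

theorem theorem4:
  fixes N d i :: nat
  assumes "N \<ge> 2" and "d \<ge> 1" and "i \<ge> 2"
    and "real N = real d * (real d + real i) / (real i - 1)"
  shows "let
      A' = (- (real d + real i + 1) + sqrt ((real d + real i + 1)\<^sup>2 + 4 * real N)) / 2;
      B' = (- (real d + 1) + sqrt ((real d - 1)\<^sup>2 + 4 * real N)) / 2;
      C' = real N * (- (real d + real i - 1) + sqrt ((real d + real i + 1)\<^sup>2 + 4 * real N))
             / (2 * (real d + real i + real N));
      D' = real N * (- (real d + 1) + sqrt ((real d - 1)\<^sup>2 + 4 * real N))
             / (2 * (real N - real d));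
      E' = A' + 1;
      F' = B' + 1
    in
      (\<forall>\<alpha> \<in> X_set N d i. \<forall>A B C D E F :: real.
         0 < A \<and> A < B \<and> B < C \<and> C < D \<and> D < E \<and> E < F \<longrightarrow>
         bij_betw_ae (Tmap2 N \<alpha>) (Omega N \<alpha> A B C D E F) (Omega N \<alpha> A B C D E F) \<longrightarrow>
         A = E - 1 \<and> A = A' \<and> B = F - 1 \<and> B = B' \<and> C = C' \<and> D = D') \<and>
      (0 < A' \<and> A' < B' \<and> B' < C' \<and> C' < D' \<and> D' < E' \<and> E' < F')"
proof -
  define n p q where "n = real N" and "p = real d" and "q = real d + real i"
  have pq: "1 \<le> p" "p + 2 \<le> q" "0 < n" using assms by (auto simp: n_def p_def q_def)
  have rel: "n * (q - p - 1) = p * q" using assms(3,4) by (simp add: n_def p_def q_def field_simps)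
  have "p < n" by (rule smallest_digit_less[OF rel pq(1,2)])

  define A' where "A' = (- (q + 1) + sqrt ((q + 1)\<^sup>2 + 4 * n)) / 2"
  define B' where "B' = (- (p + 1) + sqrt ((p - 1)\<^sup>2 + 4 * n)) / 2"
  define C' where "C' = n * (- (q - 1) + sqrt ((q + 1)\<^sup>2 + 4 * n)) / (2 * (q + n))"
  define D' where "D' = n * (- (p + 1) + sqrt ((p - 1)\<^sup>2 + 4 * n)) / (2 * (n - p))"

  have sqrtA: "sqrt ((q + 1)\<^sup>2 + 4 * n) = 2 * A' + q + 1"
    by (simp add: A'_def add_divide_distrib diff_divide_distrib)
  have sqrtB: "sqrt ((p - 1)\<^sup>2 + 4 * n) = 2 * B' + p + 1"
    by (simp add: B'_def add_divide_distrib diff_divide_distrib)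
  \<comment> \<open>The claimed values solve the two quadratic equations, so the order of the heights is available
    even if no admissible \<open>\<alpha>\<close> exists.\<close>
  have "q + 1 < sqrt ((q + 1)\<^sup>2 + 4 * n)" using pq by (intro real_less_rsqrt) simp
  then have A'pos: "0 < A'" by (simp add: A'_def)
  have "p + 1 < sqrt ((p - 1)\<^sup>2 + 4 * n)"
    using \<open>p < n\<close> by (intro real_less_rsqrt) (simp add: power2_eq_square algebra_simps)
  then have B'pos: "0 < B'" by (simp add: B'_def)
  have "(2 * A' + q + 1)\<^sup>2 = (q + 1)\<^sup>2 + 4 * n" unfolding sqrtA[symmetric] using pq by simp
  then have A'eq: "A' * (q + A' + 1) = n" by (simp add: power2_eq_square algebra_simps)
  have "(2 * B' + p + 1)\<^sup>2 = (p - 1)\<^sup>2 + 4 * n" unfolding sqrtB[symmetric] using pq by simp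
  then have B'eq: "(B' + 1) * (p + B') = n" by (simp add: power2_eq_square algebra_simps)
  have C'eq: "C' = n * (A' + 1) / (q + n)"
    unfolding C'_def sqrtA using pq by (simp add: field_simps)
  have D'eq: "D' = n * B' / (n - p)"
    unfolding D'_def sqrtB using \<open>p < n\<close> by (simp add: field_simps)

  have C'low: "C' = n / (A' + 1) - p"
  proof -
    have "A' + 1 = n / (p + (n / (A' + 1) - p))" using pq A'pos by simp
    from lower_middle_height[OF rel A'pos _ _ _ A'eq this] show ?thesis using pq C'eq by simp
  qed
  have D'low: "D' = n / B' - q"
  proof -
    have "B' = n / (q + (n / B' - q))" using pq B'pos by simp
    from upper_middle_height[OF rel B'pos _ _ \<open>p < n\<close> B'eq this] show ?thesis using pq D'eq by simp
  qed
  have order: "0 < A'" "A' < B'" "B' < C'" "C' < D'" "D' < A' + 1" "A' + 1 < B' + 1"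
    using heights_increasing[OF rel pq(1,2) A'pos B'pos pq(3) A'eq B'eq] A'pos
    unfolding C'low D'low by auto

  have heights: "A = E - 1 \<and> A = A' \<and> B = F - 1 \<and> B = B' \<and> C = C' \<and> D = D'"
    if \<alpha>: "\<alpha> \<in> X_set N d i" and h: "0 < A" "A < B" "B < C" "C < D" "D < E" "E < F"
      and bij: "bij_betw_ae (Tmap2 N \<alpha>) (Omega N \<alpha> A B C D E F) (Omega N \<alpha> A B C D E F)"
    for \<alpha> A B C D E F
  proof -
    interpret matched_parameters N d i \<alpha> using assms \<alpha> by unfold_locales
    note eqs = boundary_heights[OF h bij]
    have Eq: "E = A + 1" and Fq: "F = B + 1" by (fact eqs)+
    have sums: "q + A + 1 = real d + real i + E" "B + 1 = F" "A + 1 = E"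
      by (simp_all add: q_def Eq Fq)
    have eqA: "A = n / (q + A + 1)" using eqs(1) unfolding sums n_def of_nat_add .
    have eqB: "B = n / (q + D)" using eqs(2) unfolding n_def q_def of_nat_add .
    have eqF: "B + 1 = n / (p + B)" using eqs(3) unfolding sums n_def p_def .
    have eqE: "A + 1 = n / (p + C)" using eqs(4) unfolding sums n_def p_def .
    have Aeq: "A * (q + A + 1) = n"
      by (rule iffD1[OF nonzero_eq_divide_eq eqA]) (use h pq in simp)
    have Beq: "(B + 1) * (p + B) = n"
      by (rule iffD1[OF nonzero_eq_divide_eq eqF]) (use h pq in simp)
    have "A = A'" using outer_height_root[OF h(1) _ Aeq] pq by (simp add: A'_def)
    moreover have "0 < B" using h by linarith
    moreover have "B = B'" using inner_height_root[OF \<open>0 < B\<close> _ Beq] pq by (simp add: B'_def)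
    moreover have "C = n * (A + 1) / (q + n)"
      using lower_middle_height[OF rel h(1) _ _ pq(3) Aeq eqE] pq by simp
    moreover have "D = n * B / (n - p)"
      using upper_middle_height[OF rel \<open>0 < B\<close> _ pq(3) \<open>p < n\<close> Beq eqB] pq by simp
    ultimately show ?thesis using Eq Fq C'eq D'eq by simp
  qed
  show ?thesis
    unfolding Let_def q_def[symmetric] unfolding p_def[symmetric] n_def[symmetric]
    unfolding A'_def[symmetric] B'_def[symmetric] C'_def[symmetric] D'_def[symmetric]
    using heights order by blast
qed

end
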